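(* Let $m>n\ge 1$ be integers. Suppose that $A^*\in\mathbb{R}^{m\times n}$ and $\xi^*\in\mathbb{R}^{n}$ are generic, let $\pi$ be any permutation of the coordinates of $\mathbb{R}^{m}$, and set $y^*=\pi(A^*\xi^* )\in\mathbb{R}^m$. Then $\xi^*$ is the unique solution in $\mathbb{C}^n$ of the system of $n+1$ polynomial equations in $n$ unknowns $x=(x_1,\dots,x_n)^\top$ $$q_1(x)=\cdots=q_{n+1}(x)=0,\qquad q_\ell(x)=p_\ell(A^*x)-p_\ell(y^* ),$$ where $p_\ell=\sum_{i=1}^m y_i^\ell$ is the $\ell$-th power sum in $m$ variables.
   Context: "$A^*$ and $\xi^*$ are generic" means: there is a nonzero polynomial $g$ with real coefficients in the $mn+n$ entries of $(A,x)$, depending only on $m,n$, such that the conclusion holds for every $(A^*,\xi^* )\in\mathbb{R}^{m\times n}\times\mathbb{R}^n$ with $g(A^*,\xi^* )\neq 0$ (and every permutation $\pi$). For a vector $v=(v_1,\dots,v_m)$, $p_\ell(v)=\sum_{i=1}^m v_i^\ell$. *)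

theory Defs
  imports "HOL-Analysis.Analysis" "HOL-Library.Poly_Mapping"
begin

(* A polynomial is a finitely supported map from exponent vectors to coefficients;
   it is nonzero iff it is nonzero in the poly_mapping type. *)
type_synonym ('v, 'a) mpoly = "('v \<Rightarrow>\<^sub>0 nat) \<Rightarrow>\<^sub>0 'a"

definition eval_mpoly :: "('v::finite, 'a::comm_semiring_1) mpoly \<Rightarrow> ('v \<Rightarrow> 'a) \<Rightarrow> 'a" where
  "eval_mpoly g a =
     (\<Sum>e\<in>Poly_Mapping.keys g. Poly_Mapping.lookup g e * (\<Prod>v\<in>UNIV. a v ^ Poly_Mapping.lookup e v))"

(* The point of real (mn+n)-space given by (A, x): the variable Inl (i, j) stands for the
   entry A_ij, the variable Inr j for x_j. *)
definition entries :: "real ^ 'n ^ 'm \<Rightarrow> real ^ 'n \<Rightarrow> ('m \<times> 'n) + 'n \<Rightarrow> real" where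
  "entries A x = case_sum (\<lambda>(i, j). A $ i $ j) (\<lambda>j. x $ j)"

definition power_sum :: "nat \<Rightarrow> ('a::comm_semiring_1) ^ 'm \<Rightarrow> 'a" where
  "power_sum l v = (\<Sum>i\<in>UNIV. v $ i ^ l)"

definition permute_coords :: "('m \<Rightarrow> 'm) \<Rightarrow> 'a ^ 'm \<Rightarrow> 'a ^ 'm" where
  "permute_coords \<pi> v = (\<chi> i. v $ \<pi> i)"

definition complex_vec :: "real ^ 'n \<Rightarrow> complex ^ 'n" where
  "complex_vec v = (\<chi> j. complex_of_real (v $ j))"

definition q :: "real ^ 'n ^ 'm \<Rightarrow> real ^ 'm \<Rightarrow> nat \<Rightarrow> complex ^ 'n \<Rightarrow> complex" where
  "q A y l x = power_sum l (map_matrix complex_of_real A *v x) - complex_of_real (power_sum l y)"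

end

theory Submission
  imports Defs "HOL-Computational_Algebra.Polynomial"
begin

text \<open>A second solution \<open>x\<close> that is parallel to \<open>\<xi>\<close> is excluded by the linear equation, unless the
  coordinate sum of \<open>A \<xi>\<close> or a coordinate of \<open>\<xi>\<close> vanishes. If \<open>x\<close> and \<open>\<xi>\<close> are independent, then
  \<open>A x\<close> and \<open>A \<xi>\<close> can be prescribed independently, and the \<open>n + 1\<close> power sum equations cut the
  dimension \<open>m n + 2 n\<close> of the space of triples \<open>(A, \<xi>, x)\<close> down to \<open>m n + n - 1\<close>; hence the bad pairs
  \<open>(A, \<xi>)\<close> cannot fill the space of dimension \<open>m n + n\<close>. The dimension argument is replaced by counting:
  the coordinates of a bad pair are fractions over a ring that is finite over a polynomial
  ring in \<open>m n + n - 1\<close> parameters, so polynomials of degree \<open>D\<close> in these coordinates span a space of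
  dimension \<open>O(D^(m n + n - 1))\<close>, which is less than the number of monomials.\<close>

section \<open>Linear conditions on polynomial coefficients and thin sets\<close>

text \<open>Gaussian elimination by induction on the set of equations: each equation is used to
  eliminate at most one unknown.\<close>

lemma underdetermined_system:
  fixes c :: "'e \<Rightarrow> 'b \<Rightarrow> real"
  assumes "finite B" "finite E" "card B < card E"
  shows "\<exists>a. (\<exists>e\<in>E. a e \<noteq> 0) \<and> (\<forall>b\<in>B. (\<Sum>e\<in>E. a e * c e b) = 0)"
  using assms
proof (induction B arbitrary: E c rule: finite_induct)
  case empty
  then obtain e where "e \<in> E" by fastforce
  then show ?case by (intro exI[of _ "\<lambda>_. 1"]) auto
next
  case (insert b B)
  show ?case
  proof (cases "\<forall>e\<in>E. c e b = 0")
    case True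
    obtain a where "\<exists>e\<in>E. a e \<noteq> 0" "\<forall>b\<in>B. (\<Sum>e\<in>E. a e * c e b) = 0"
      using insert.IH[of E c] insert.prems insert.hyps by auto
    with True show ?thesis by (intro exI[of _ a]) auto
  next
    case False
    then obtain e0 where e0: "e0 \<in> E" "c e0 b \<noteq> 0" by auto
    define E' where "E' = E - {e0}"
    have E': "finite E'" "E = insert e0 E'" "e0 \<notin> E'" using e0 insert.prems by (auto simp: E'_def)
    have "card B < card E'"
      using insert.prems insert.hyps E' by simp
    then obtain a where a: "\<exists>e\<in>E'. a e \<noteq> 0"
      "\<forall>b'\<in>B. (\<Sum>e\<in>E'. a e * (c e b' - c e b / c e0 b * c e0 b')) = 0"
      using insert.IH[of E' "\<lambda>e b'. c e b' - c e b / c e0 b * c e0 b'"] E' by blast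
    \<comment> \<open>Equation \<open>b\<close>, solved for the pivot unknown \<open>e0\<close>. The
      reduced system is what the other equations become once this value is substituted.\<close>
    define z where "z = - (\<Sum>e\<in>E'. a e * c e b) / c e0 b"
    have split: "(\<Sum>e\<in>E. (a(e0 := z)) e * c e b') = z * c e0 b' + (\<Sum>e\<in>E'. a e * c e b')" for b'
    proof -
      have "(\<Sum>e\<in>E'. (a(e0 := z)) e * c e b') = (\<Sum>e\<in>E'. a e * c e b')"
        using E' by (intro sum.cong) auto
      then show ?thesis using E' by simp
    qed
    have "z * c e0 b' + (\<Sum>e\<in>E'. a e * c e b') = 0" if "b' \<in> B" for b'
    proof -
      have "z * c e0 b' = - (\<Sum>e\<in>E'. a e * (c e b / c e0 b * c e0 b'))"
        by (simp add: z_def sum_distrib_right sum_divide_distrib mult.assoc)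
      then show ?thesis
        using a(2)[rule_format, OF that] by (simp add: right_diff_distrib sum_subtractf)
    qed
    moreover have "z * c e0 b + (\<Sum>e\<in>E'. a e * c e b) = 0"
      using e0 by (simp add: z_def)
    moreover have "\<exists>e\<in>E. (a(e0 := z)) e \<noteq> 0"
      using a(1) E' by auto
    ultimately show ?thesis
      by (intro exI[of _ "a(e0 := z)"]) (auto simp only: split)
  qed
qed

text \<open>Bounding every exponent separately, instead of the total degree, makes the number of
  monomials a pure power of \<open>D + 1\<close>.\<close>

definition grid :: "nat \<Rightarrow> ('v::finite \<Rightarrow> nat) set" where
  "grid D = {e. \<forall>v. e v \<le> D}"

lemma grid_PiE: "grid D = PiE UNIV (\<lambda>_. {..D})"
  by (auto simp: grid_def PiE_def)

lemma finite_grid [simp]: "finite (grid D)"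
  unfolding grid_PiE by (intro finite_PiE) auto

lemma card_grid: "card (grid D :: ('v::finite \<Rightarrow> nat) set) = (D + 1) ^ CARD('v)"
  unfolding grid_PiE by (subst card_PiE) auto

definition grid_poly :: "nat \<Rightarrow> (('v::finite \<Rightarrow> nat) \<Rightarrow> real) \<Rightarrow> ('v \<Rightarrow> real) \<Rightarrow> real" where
  "grid_poly D a x = (\<Sum>e\<in>grid D. a e * (\<Prod>v\<in>UNIV. x v ^ e v))"

text \<open>The Hilbert function of a thin set grows like that of a hypersurface.  Thinness, unlike
  lying on a hypersurface, passes to finite unions without knowing that multivariate
  polynomials have no zero divisors.\<close>

definition thin :: "('v::finite \<Rightarrow> real) set \<Rightarrow> bool" where
  "thin P \<longleftrightarrow> (\<exists>C. \<forall>D. \<exists>L. finite L \<and> card L \<le> C * (D + 1) ^ (CARD('v) - 1) \<and>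
     (\<forall>a. (\<forall>l\<in>L. (\<Sum>e\<in>grid D. a e * l e) = 0) \<longrightarrow> (\<forall>x\<in>P. grid_poly D a x = 0)))"

lemma thin_empty: "thin {}"
  unfolding thin_def by (intro exI[of _ 0] allI exI[of _ "{}"]) auto

text \<open>The conditions for both sets are imposed together: the constants add up, and the
  exponent of \<open>D + 1\<close> is unchanged.\<close>

lemma thin_Un:
  fixes P Q :: "('v::finite \<Rightarrow> real) set"
  assumes "thin P" "thin Q"
  shows "thin (P \<union> Q)"
proof -
  obtain C where C: "\<And>D. \<exists>L. finite L \<and> card L \<le> C * (D + 1) ^ (CARD('v) - 1) \<and>
     (\<forall>a. (\<forall>l\<in>L. (\<Sum>e\<in>grid D. a e * l e) = 0) \<longrightarrow> (\<forall>x\<in>P. grid_poly D a x = 0))"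
    using assms(1) unfolding thin_def by blast
  obtain C' where C': "\<And>D. \<exists>L. finite L \<and> card L \<le> C' * (D + 1) ^ (CARD('v) - 1) \<and>
     (\<forall>a. (\<forall>l\<in>L. (\<Sum>e\<in>grid D. a e * l e) = 0) \<longrightarrow> (\<forall>x\<in>Q. grid_poly D a x = 0))"
    using assms(2) unfolding thin_def by blast
  show ?thesis
    unfolding thin_def
  proof (intro exI[of _ "C + C'"] allI)
    fix D
    obtain L where L: "finite L" "card L \<le> C * (D + 1) ^ (CARD('v) - 1)"
     "\<forall>a. (\<forall>l\<in>L. (\<Sum>e\<in>grid D. a e * l e) = 0) \<longrightarrow> (\<forall>x\<in>P. grid_poly D a x = 0)"
      using C by blast
    obtain L' where L': "finite L'" "card L' \<le> C' * (D + 1) ^ (CARD('v) - 1)"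
     "\<forall>a. (\<forall>l\<in>L'. (\<Sum>e\<in>grid D. a e * l e) = 0) \<longrightarrow> (\<forall>x\<in>Q. grid_poly D a x = 0)"
      using C' by blast
    have "card (L \<union> L') \<le> (C + C') * (D + 1) ^ (CARD('v) - 1)"
      using card_Un_le[of L L'] L(2) L'(2) by (simp add: distrib_right)
    moreover have "\<forall>x\<in>P \<union> Q. grid_poly D a x = 0"
      if "\<forall>l\<in>L \<union> L'. (\<Sum>e\<in>grid D. a e * l e) = 0" for a
      using L(3) L'(3) that by blast
    ultimately show "\<exists>L. finite L \<and> card L \<le> (C + C') * (D + 1) ^ (CARD('v) - 1) \<and>
     (\<forall>a. (\<forall>l\<in>L. (\<Sum>e\<in>grid D. a e * l e) = 0) \<longrightarrow> (\<forall>x\<in>P \<union> Q. grid_poly D a x = 0))"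
      using L(1) L'(1) by (intro exI[of _ "L \<union> L'"]) blast
  qed
qed

lemma thin_UNION:
  assumes "finite K" "\<And>k. k \<in> K \<Longrightarrow> thin (P k)"
  shows "thin (\<Union>k\<in>K. P k)"
  using assms by (induction rule: finite_induct) (auto intro: thin_Un thin_empty)

text \<open>Over a finite set of variables every exponent function has finite support, so
  \<open>lookup\<close> is a bijection between the two kinds of exponents and coefficient families
  can be carried across.\<close>

lemma grid_poly_eval_mpoly:
  obtains g :: "('v::finite, real) mpoly"
  where "\<And>x. eval_mpoly g x = grid_poly D a x"
    and "\<And>e. e \<in> grid D \<Longrightarrow> a e \<noteq> 0 \<Longrightarrow> g \<noteq> 0"
proof -
  let ?lk = "Poly_Mapping.lookup :: ('v \<Rightarrow>\<^sub>0 nat) \<Rightarrow> 'v \<Rightarrow> nat"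
  define f where "f e = (if ?lk e \<in> grid D then a (?lk e) else 0)" for e
  have surj: "\<exists>e'. ?lk e' = e" for e
    by (rule exI[of _ "Abs_poly_mapping e"]) (simp add: Abs_poly_mapping_inverse)
  have bij: "bij_betw ?lk (?lk -` grid D) (grid D)"
  proof (rule bij_betwI')
    show "(?lk e = ?lk e') = (e = e')" for e e'
      by (rule poly_mapping.lookup_inject)
    show "\<exists>e'\<in>?lk -` grid D. e = ?lk e'" if "e \<in> grid D" for e
      using surj[of e] that by auto
  qed simp
  have fin: "finite (?lk -` grid D)"
    using bij_betw_finite[OF bij] by simp
  have sub: "{e. f e \<noteq> 0} \<subseteq> ?lk -` grid D" by (auto simp: f_def)
  then have fin': "finite {e. f e \<noteq> 0}" using fin finite_subset by blast
  define g where "g = Abs_poly_mapping f"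
  have lg: "Poly_Mapping.lookup g = f"
    using fin' by (simp add: g_def Abs_poly_mapping_inverse)
  have "eval_mpoly g x = grid_poly D a x" for x
  proof -
    have "eval_mpoly g x = (\<Sum>e\<in>?lk -` grid D. f e * (\<Prod>v\<in>UNIV. x v ^ ?lk e v))"
      unfolding eval_mpoly_def lg
      by (rule sum.mono_neutral_left[OF fin]) (use sub in \<open>auto simp: in_keys_iff lg\<close>)
    also have "\<dots> = (\<Sum>e\<in>?lk -` grid D. a (?lk e) * (\<Prod>v\<in>UNIV. x v ^ ?lk e v))"
      by (intro sum.cong) (auto simp: f_def)
    also have "\<dots> = grid_poly D a x"
      unfolding grid_poly_def by (rule sum.reindex_bij_betw[OF bij])
    finally show ?thesis .
  qed
  moreover have "g \<noteq> 0" if e: "e \<in> grid D" "a e \<noteq> 0" for e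
  proof -
    obtain e' where "?lk e' = e" using surj by blast
    then have "Poly_Mapping.lookup g e' \<noteq> 0" using e by (simp add: lg f_def)
    then show ?thesis by auto
  qed
  ultimately show ?thesis using that by blast
qed

text \<open>In \<open>N\<close> variables there are \<open>(D + 1) ^ N\<close> monomials against at
  most \<open>C * (D + 1) ^ (N - 1)\<close> conditions, so \<open>D = C\<close> already leaves a
  nonzero polynomial.\<close>

lemma thin_imp_hypersurface:
  fixes P :: "('v::finite \<Rightarrow> real) set"
  assumes "thin P"
  shows "\<exists>g :: ('v, real) mpoly. g \<noteq> 0 \<and> (\<forall>x\<in>P. eval_mpoly g x = 0)"
proof -
  obtain C where C: "\<And>D. \<exists>L. finite L \<and> card L \<le> C * (D + 1) ^ (CARD('v) - 1) \<and>
     (\<forall>a. (\<forall>l\<in>L. (\<Sum>e\<in>grid D. a e * l e) = 0) \<longrightarrow> (\<forall>x\<in>P. grid_poly D a x = 0))"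
    using assms unfolding thin_def by blast
  obtain L where L: "finite L" "card L \<le> C * (C + 1) ^ (CARD('v) - 1)"
     "\<forall>a. (\<forall>l\<in>L. (\<Sum>e\<in>grid C. a e * l e) = 0) \<longrightarrow> (\<forall>x\<in>P. grid_poly C a x = 0)"
    using C[of C] by blast
  note L(2)
  also have "C * (C + 1) ^ (CARD('v) - 1) < (C + 1) * (C + 1) ^ (CARD('v) - 1)"
    by simp
  also have "\<dots> = card (grid C :: ('v \<Rightarrow> nat) set)"
    unfolding card_grid power_Suc[symmetric] by simp
  finally obtain a where a: "\<exists>e\<in>(grid C :: ('v \<Rightarrow> nat) set). a e \<noteq> 0"
      "\<forall>l\<in>L. (\<Sum>e\<in>grid C. a e * l e) = 0"
    using underdetermined_system[of L "grid C :: ('v \<Rightarrow> nat) set" "\<lambda>e l. l e"] L(1) by auto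
  obtain g :: "('v, real) mpoly" where g: "\<And>x. eval_mpoly g x = grid_poly C a x"
    "\<And>e. e \<in> grid C \<Longrightarrow> a e \<noteq> 0 \<Longrightarrow> g \<noteq> 0"
    using grid_poly_eval_mpoly[of C a] by blast
  have "\<forall>x\<in>P. eval_mpoly g x = 0"
    using L(3) a(2) g(1) by simp
  then show ?thesis using a(1) g(2) by blast
qed

section \<open>Filtered modules of functions spanned by monomials\<close>

text \<open>The parameters \<open>t\<close> and the elements \<open>u\<close>, meant to be integral
  over them, are functions on a set \<open>S\<close> of points. Equations that define
  \<open>S\<close> can thus be used as identities between functions.\<close>

locale monomial_module =
  fixes S :: "'s set" and I :: "'i set" and t :: "'i \<Rightarrow> 's \<Rightarrow> complex"
    and J :: "'j set" and u :: "'j \<Rightarrow> 's \<Rightarrow> complex" and m :: nat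
  assumes finite_I: "finite I" and finite_J: "finite J" and m_pos: "0 < m"
begin

text \<open>Powers of \<open>u\<close> stop below \<open>m\<close>, as a monic equation of degree
  \<open>m\<close> reduces the higher ones. Hence only the number of parameters governs the growth
  in \<open>d\<close>.\<close>

definition exponents :: "nat \<Rightarrow> (('i \<Rightarrow> nat) \<times> ('j \<Rightarrow> nat)) set" where
  "exponents d = PiE I (\<lambda>_. {..d}) \<times> PiE J (\<lambda>_. {..<m})"

definition mon :: "('i \<Rightarrow> nat) \<times> ('j \<Rightarrow> nat) \<Rightarrow> 's \<Rightarrow> complex" where
  "mon b s = (\<Prod>i\<in>I. t i s ^ fst b i) * (\<Prod>j\<in>J. u j s ^ snd b j)"

text \<open>The coefficients are real although the values are complex, because they will serve as
  conditions on the coefficients of real polynomials.\<close>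

definition mon_span :: "nat \<Rightarrow> ('s \<Rightarrow> complex) set" where
  "mon_span d = {f. \<exists>c. \<forall>s\<in>S. f s = (\<Sum>b\<in>exponents d. complex_of_real (c b) * mon b s)}"

text \<open>This stands in for membership in the ring generated by \<open>t\<close> and
  \<open>u\<close>: multiplication by \<open>f\<close> raises the degree by a constant independent
  of \<open>d\<close>. The property is closed under ring operations, and powers of \<open>f\<close>
  cost linearly many steps.\<close>

definition bounded_shift :: "('s \<Rightarrow> complex) \<Rightarrow> bool" where
  "bounded_shift f \<longleftrightarrow> (\<exists>c. \<forall>d. \<forall>g\<in>mon_span d. (\<lambda>s. f s * g s) \<in> mon_span (d + c))"

lemma finite_exponents [simp]: "finite (exponents d)"
  unfolding exponents_def using finite_I finite_J by (auto intro!: finite_PiE)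

lemma card_exponents: "card (exponents d) = (d + 1) ^ card I * m ^ card J"
  unfolding exponents_def using finite_I finite_J by (simp add: card_cartesian_product card_PiE)

lemma exponents_mono: "d \<le> d' \<Longrightarrow> exponents d \<subseteq> exponents d'"
  unfolding exponents_def by (intro Sigma_mono PiE_mono) auto

lemma mon_span_cong: "f \<in> mon_span d \<Longrightarrow> (\<And>s. s \<in> S \<Longrightarrow> g s = f s) \<Longrightarrow> g \<in> mon_span d"
  unfolding mon_span_def by auto

lemma mon_span_add:
  assumes "f \<in> mon_span d" "g \<in> mon_span d" shows "(\<lambda>s. f s + g s) \<in> mon_span d"
proof -
  obtain c c' where "\<forall>s\<in>S. f s = (\<Sum>b\<in>exponents d. complex_of_real (c b) * mon b s)"
    "\<forall>s\<in>S. g s = (\<Sum>b\<in>exponents d. complex_of_real (c' b) * mon b s)"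
    using assms unfolding mon_span_def by auto
  then show ?thesis
    unfolding mon_span_def by (auto intro!: exI[of _ "\<lambda>b. c b + c' b"] simp: sum.distrib distrib_right)
qed

lemma mon_span_scale:
  assumes "f \<in> mon_span d" shows "(\<lambda>s. complex_of_real r * f s) \<in> mon_span d"
proof -
  obtain c where "\<forall>s\<in>S. f s = (\<Sum>b\<in>exponents d. complex_of_real (c b) * mon b s)"
    using assms unfolding mon_span_def by auto
  then show ?thesis
    unfolding mon_span_def by (auto intro!: exI[of _ "\<lambda>b. r * c b"] simp: sum_distrib_left mult.assoc)
qed

lemma mon_span_zero: "(\<lambda>s. 0) \<in> mon_span d"
  unfolding mon_span_def by (auto intro!: exI[of _ "\<lambda>b. 0"])

lemma mon_span_sum: "finite X \<Longrightarrow> (\<And>x. x \<in> X \<Longrightarrow> f x \<in> mon_span d) \<Longrightarrow> (\<lambda>s. \<Sum>x\<in>X. f x s) \<in> mon_span d"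
  by (induction rule: finite_induct) (auto intro: mon_span_zero mon_span_add)

lemma mon_in_mon_span: "b \<in> exponents d \<Longrightarrow> mon b \<in> mon_span d"
  unfolding mon_span_def
  by (auto intro!: exI[of _ "\<lambda>b'. if b' = b then 1 else 0"]
      simp: if_distrib[of complex_of_real] if_distrib[of "\<lambda>x. x * _"] cong: if_cong)

lemma mon_span_mono:
  assumes "d \<le> d'" "f \<in> mon_span d" shows "f \<in> mon_span d'"
proof -
  obtain c where c: "\<forall>s\<in>S. f s = (\<Sum>b\<in>exponents d. complex_of_real (c b) * mon b s)"
    using assms unfolding mon_span_def by auto
  have "(\<lambda>s. \<Sum>b\<in>exponents d. complex_of_real (c b) * mon b s) \<in> mon_span d'"
    using exponents_mono[OF assms(1)] by (intro mon_span_sum mon_span_scale mon_in_mon_span) auto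
  then show ?thesis by (rule mon_span_cong) (use c in auto)
qed

lemma one_in_mon_span: "(\<lambda>s. 1) \<in> mon_span 0"
proof -
  define b :: "('i \<Rightarrow> nat) \<times> ('j \<Rightarrow> nat)" where "b = (restrict (\<lambda>_. 0) I, restrict (\<lambda>_. 0) J)"
  \<comment> \<open>The exponent 0 is admissible for \<open>u\<close> because \<open>m\<close> is
    positive.\<close>
  have "b \<in> exponents 0" using m_pos by (auto simp: b_def exponents_def)
  moreover have "mon b = (\<lambda>s. 1)" by (auto simp: b_def mon_def)
  ultimately show ?thesis using mon_in_mon_span by metis
qed

lemma bounded_shift_monI:
  assumes "\<And>d b. b \<in> exponents d \<Longrightarrow> (\<lambda>s. f s * mon b s) \<in> mon_span (d + c)"
  shows "bounded_shift f"
  unfolding bounded_shift_def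
proof (intro exI[of _ c] allI ballI)
  fix d g assume "g \<in> mon_span d"
  then obtain k where k: "\<forall>s\<in>S. g s = (\<Sum>b\<in>exponents d. complex_of_real (k b) * mon b s)"
    unfolding mon_span_def by auto
  have "(\<lambda>s. \<Sum>b\<in>exponents d. complex_of_real (k b) * (f s * mon b s)) \<in> mon_span (d + c)"
    by (intro mon_span_sum mon_span_scale assms) auto
  then show "(\<lambda>s. f s * g s) \<in> mon_span (d + c)"
    by (rule mon_span_cong) (use k in \<open>auto simp: sum_distrib_left algebra_simps\<close>)
qed

lemma bounded_shift_cong: "bounded_shift f \<Longrightarrow> (\<And>s. s \<in> S \<Longrightarrow> g s = f s) \<Longrightarrow> bounded_shift g"
  unfolding bounded_shift_def by (metis (no_types, lifting) mon_span_cong)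

lemma bounded_shift_const: "bounded_shift (\<lambda>s. complex_of_real r)"
  unfolding bounded_shift_def by (intro exI[of _ 0]) (auto intro: mon_span_scale)

lemma bounded_shift_add:
  assumes "bounded_shift f" "bounded_shift g" shows "bounded_shift (\<lambda>s. f s + g s)"
proof -
  obtain c c' where *: "\<And>d h. h \<in> mon_span d \<Longrightarrow> (\<lambda>s. f s * h s) \<in> mon_span (d + c)"
    "\<And>d h. h \<in> mon_span d \<Longrightarrow> (\<lambda>s. g s * h s) \<in> mon_span (d + c')"
    using assms unfolding bounded_shift_def by blast
  have "(\<lambda>s. f s * h s + g s * h s) \<in> mon_span (d + (c + c'))" if "h \<in> mon_span d" for d h
    using *[OF that] by (intro mon_span_add) (auto elim: mon_span_mono[rotated])
  then show ?thesis unfolding bounded_shift_def by (auto simp: distrib_right)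
qed

lemma bounded_shift_mult:
  assumes "bounded_shift f" "bounded_shift g" shows "bounded_shift (\<lambda>s. f s * g s)"
proof -
  obtain c c' where *: "\<And>d h. h \<in> mon_span d \<Longrightarrow> (\<lambda>s. f s * h s) \<in> mon_span (d + c)"
    "\<And>d h. h \<in> mon_span d \<Longrightarrow> (\<lambda>s. g s * h s) \<in> mon_span (d + c')"
    using assms unfolding bounded_shift_def by blast
  have "(\<lambda>s. f s * (g s * h s)) \<in> mon_span (d + (c' + c))" if "h \<in> mon_span d" for d h
    using *(1)[OF *(2)[OF that]] by (simp add: add.assoc)
  then show ?thesis unfolding bounded_shift_def by (auto simp: mult.assoc)
qed

lemma bounded_shift_zero: "bounded_shift (\<lambda>s. 0)" and bounded_shift_one: "bounded_shift (\<lambda>s. 1)"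
  using bounded_shift_const[of 0] bounded_shift_const[of 1] by auto

lemma bounded_shift_uminus: "bounded_shift f \<Longrightarrow> bounded_shift (\<lambda>s. - f s)"
  using bounded_shift_mult[OF bounded_shift_const[of "-1"], of f] by simp

lemma bounded_shift_diff: "bounded_shift f \<Longrightarrow> bounded_shift g \<Longrightarrow> bounded_shift (\<lambda>s. f s - g s)"
  using bounded_shift_add[OF _ bounded_shift_uminus, of f g] by simp

lemma bounded_shift_sum: "(\<And>x. x \<in> X \<Longrightarrow> bounded_shift (f x)) \<Longrightarrow> bounded_shift (\<lambda>s. \<Sum>x\<in>X. f x s)"
  by (induction X rule: infinite_finite_induct) (auto intro: bounded_shift_zero bounded_shift_add)

lemma bounded_shift_t:
  assumes "i \<in> I" shows "bounded_shift (t i)"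
proof (rule bounded_shift_monI)
  fix d b assume b: "b \<in> exponents d"
  define b' where "b' = ((fst b)(i := Suc (fst b i)), snd b)"
  have "b' \<in> exponents (d + 1)"
    using b assms unfolding exponents_def b'_def
    by (auto simp: PiE_iff extensional_def le_SucI)
  moreover have "mon b' = (\<lambda>s. t i s * mon b s)"
    using finite_I assms by (auto simp: b'_def mon_def prod.remove[of I i])
  ultimately show "(\<lambda>s. t i s * mon b s) \<in> mon_span (d + 1)"
    using mon_in_mon_span by metis
qed

text \<open>Multiplying a monomial by \<open>u j\<close> raises one exponent by 1. If this reaches
  \<open>m\<close>, the integral equation rewrites the power by lower ones, at the cost of the
  shifts of the coefficients \<open>c k\<close>.\<close>

lemma bounded_shift_integral:
  assumes j: "j \<in> J" and c: "\<And>k. k < m \<Longrightarrow> bounded_shift (c k)"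
    and eq: "\<And>s. s \<in> S \<Longrightarrow> u j s ^ m = (\<Sum>k<m. c k s * u j s ^ k)"
  shows "bounded_shift (u j)"
proof -
  have "\<forall>k. \<exists>C. k < m \<longrightarrow> (\<forall>d. \<forall>g\<in>mon_span d. (\<lambda>s. c k s * g s) \<in> mon_span (d + C))"
    using c unfolding bounded_shift_def by blast
  then obtain C where C: "\<And>k d g. k < m \<Longrightarrow> g \<in> mon_span d \<Longrightarrow> (\<lambda>s. c k s * g s) \<in> mon_span (d + C k)"
    by metis
  define K where "K = (\<Sum>k<m. C k)"
  have K: "C k \<le> K" if "k < m" for k
    unfolding K_def using that by (intro member_le_sum) auto
  show ?thesis
  proof (rule bounded_shift_monI)
    fix d b assume b: "b \<in> exponents d"
    \<comment> \<open>The monomial \<open>b\<close> with the exponent of \<open>u j\<close> replaced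
      by \<open>k\<close>; \<open>R\<close> below is the factor that all of these share.\<close>
    define b' where "b' k = (fst b, (snd b)(j := k))" for k
    have b': "b' k \<in> exponents d" if "k < m" for k
      using b j that unfolding exponents_def b'_def by (auto simp: PiE_iff extensional_def)
    have bj: "snd b j < m" using b j by (auto simp: exponents_def)
    define R where "R s = (\<Prod>i\<in>I. t i s ^ fst b i) * (\<Prod>j\<in>J - {j}. u j s ^ snd b j)" for s
    have mon': "mon (b' k) s = R s * u j s ^ k" for k s
      using finite_J j by (auto simp: b'_def mon_def R_def prod.remove[of J j])
    have mon: "mon b s = R s * u j s ^ snd b j" for s
      using finite_J j by (auto simp: mon_def R_def prod.remove[of J j])
    show "(\<lambda>s. u j s * mon b s) \<in> mon_span (d + K)"
    proof (cases "Suc (snd b j) < m")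
      case True
      from mon_in_mon_span[OF b'[OF True]] have "mon (b' (Suc (snd b j))) \<in> mon_span (d + K)"
        by (rule mon_span_mono[rotated]) simp
      then show ?thesis by (rule mon_span_cong) (auto simp: mon mon')
    next
      case False
      then have m: "Suc (snd b j) = m" using bj by simp
      have "(\<lambda>s. \<Sum>k<m. c k s * mon (b' k) s) \<in> mon_span (d + K)"
      proof (intro mon_span_sum)
        fix k assume "k \<in> {..<m}"
        then have k: "k < m" by simp
        show "(\<lambda>s. c k s * mon (b' k) s) \<in> mon_span (d + K)"
          by (rule mon_span_mono[OF _ C[OF k mon_in_mon_span[OF b'[OF k]]]]) (simp add: K k)
      qed simp
      then show ?thesis
      proof (rule mon_span_cong)
        fix s assume "s \<in> S"
        have "u j s * mon b s = R s * u j s ^ m"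
          by (simp add: mon m[symmetric])
        then show "u j s * mon b s = (\<Sum>k<m. c k s * mon (b' k) s)"
          using eq[OF \<open>s \<in> S\<close>] by (simp add: mon' sum_distrib_left algebra_simps)
      qed
    qed
  qed
qed

lemma power_mult_in_mon_span:
  assumes "\<And>d g. g \<in> mon_span d \<Longrightarrow> (\<lambda>s. f s * g s) \<in> mon_span (d + c)" "h \<in> mon_span d"
  shows "(\<lambda>s. f s ^ k * h s) \<in> mon_span (d + k * c)"
proof (induction k)
  case 0
  then show ?case using assms(2) by simp
next
  case (Suc k)
  from assms(1)[OF Suc] show ?case by (simp add: mult.assoc add_ac)
qed

text \<open>A monomial in the fractions \<open>G v / \<Delta>\<close>, multiplied by a power of
  \<open>\<Delta>\<close> that depends only on \<open>D\<close>, lies in a span of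
  \<open>O(D ^ card I)\<close> monomials. Expanding there turns the vanishing of a polynomial on
  \<open>P\<close> into that many linear conditions on its coefficients.\<close>

lemma thin_fractions:
  fixes P :: "('v::finite \<Rightarrow> real) set" and G :: "'v \<Rightarrow> 's \<Rightarrow> complex"
  assumes card: "card I < CARD('v)"
    and Delta: "bounded_shift \<Delta>" and G: "\<And>v. bounded_shift (G v)"
    and P: "\<And>x. x \<in> P \<Longrightarrow> \<exists>s\<in>S. \<Delta> s \<noteq> 0 \<and> (\<forall>v. complex_of_real (x v) * \<Delta> s = G v s)"
  shows "thin P"
proof -
  define N where "N = CARD('v)"
  obtain c0 where c0: "\<And>d g. g \<in> mon_span d \<Longrightarrow> (\<lambda>s. \<Delta> s * g s) \<in> mon_span (d + c0)"
    using Delta unfolding bounded_shift_def by blast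
  have "\<forall>v. \<exists>c. \<forall>d. \<forall>g\<in>mon_span d. (\<lambda>s. G v s * g s) \<in> mon_span (d + c)"
    using G unfolding bounded_shift_def by blast
  then obtain c1 where c1: "\<And>v d g. g \<in> mon_span d \<Longrightarrow> (\<lambda>s. G v s * g s) \<in> mon_span (d + c1 v)"
    by metis
  \<comment> \<open>One shift that serves \<open>\<Delta>\<close> and all \<open>G v\<close> at
    once.\<close>
  define c where "c = c0 + sum c1 UNIV"
  have "c1 v \<le> c" for v
    unfolding c_def by (intro trans_le_add2 member_le_sum) auto
  then have cG: "\<And>v d g. g \<in> mon_span d \<Longrightarrow> (\<lambda>s. G v s * g s) \<in> mon_span (d + c)"
    using c1 by (meson mon_span_mono add_left_mono)
  have cD: "\<And>d g. g \<in> mon_span d \<Longrightarrow> (\<lambda>s. \<Delta> s * g s) \<in> mon_span (d + c)"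
    using c0 mon_span_mono by (metis add_left_mono c_def le_add1)
  \<comment> \<open>The monomial with exponents \<open>e\<close>, homogenized to degree
    \<open>D\<close> in each variable by powers of \<open>\<Delta>\<close>. The subset
    \<open>X\<close> of the variables is there for the induction.\<close>
  define f where "f D X e s = (\<Prod>v\<in>X. G v s ^ e v * \<Delta> s ^ (D - e v))"
    for D :: nat and X :: "'v set" and e s
  have f_in: "f D X e \<in> mon_span (card X * D * c)" if "finite X" "e \<in> grid D" for D X e
    using that(1)
  proof (induction rule: finite_induct)
    case empty
    then show ?case using one_in_mon_span by (simp add: f_def)
  next
    case (insert v X)
    have "(\<lambda>s. G v s ^ e v * (\<Delta> s ^ (D - e v) * f D X e s))
        \<in> mon_span ((card X * D * c + (D - e v) * c) + e v * c)"
      by (intro power_mult_in_mon_span cG cD insert)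
    moreover have "(card X * D * c + (D - e v) * c) + e v * c = card (insert v X) * D * c"
    proof -
      have "e v \<le> D" using that by (auto simp: grid_def)
      then have "(D - e v) * c + e v * c = D * c"
        by (metis add_mult_distrib le_add_diff_inverse2)
      then show ?thesis using insert by (simp add: algebra_simps)
    qed
    moreover have "f D (insert v X) e = (\<lambda>s. G v s ^ e v * (\<Delta> s ^ (D - e v) * f D X e s))"
      using insert by (auto simp: f_def mult.assoc)
    ultimately show ?case by simp
  qed
  show ?thesis
    unfolding thin_def
  proof (intro exI[of _ "(N * c + 1) ^ (N - 1) * m ^ card J"] allI)
    fix D :: nat
    have "\<forall>e\<in>grid D. \<exists>k. \<forall>s\<in>S. f D UNIV e s =
        (\<Sum>b\<in>exponents (N * D * c). complex_of_real (k b) * mon b s)"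
      using f_in[of UNIV] unfolding mon_span_def N_def by (auto simp del: of_real_sum)
    then obtain k where k: "\<And>e s. e \<in> grid D \<Longrightarrow> s \<in> S \<Longrightarrow> f D UNIV e s =
        (\<Sum>b\<in>exponents (N * D * c). complex_of_real (k e b) * mon b s)"
      by metis
    \<comment> \<open>One functional for each spanning monomial \<open>b\<close>: it sends a
      coefficient family to the coefficient of \<open>b\<close> in the expanded polynomial.\<close>
    define L where "L = (\<lambda>b e. k e b) ` exponents (N * D * c)"
    have "card L \<le> card (exponents (N * D * c))"
      unfolding L_def by (rule card_image_le) simp
    also have "\<dots> = (N * D * c + 1) ^ card I * m ^ card J" by (rule card_exponents)
    also have "\<dots> \<le> (N * D * c + 1) ^ (N - 1) * m ^ card J"
      using card by (intro mult_right_mono power_increasing) (auto simp: N_def)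
    \<comment> \<open>Separates the dependence on \<open>D\<close> from the constant.\<close>
    also have "\<dots> \<le> ((N * c + 1) * (D + 1)) ^ (N - 1) * m ^ card J"
      by (intro mult_right_mono power_mono) (auto simp: algebra_simps)
    also have "\<dots> = (N * c + 1) ^ (N - 1) * m ^ card J * (D + 1) ^ (CARD('v) - 1)"
      by (simp only: power_mult_distrib N_def mult_ac)
    finally have "card L \<le> \<dots>" .
    moreover have "grid_poly D a x = 0"
      if a: "\<forall>l\<in>L. (\<Sum>e\<in>grid D. a e * l e) = 0" and x: "x \<in> P" for a x
    proof -
      obtain s where s: "s \<in> S" "\<Delta> s \<noteq> 0" "\<And>v. complex_of_real (x v) * \<Delta> s = G v s"
        using P[OF x] by blast
      have fx: "f D UNIV e s = complex_of_real (\<Prod>v\<in>UNIV. x v ^ e v) * \<Delta> s ^ (D * N)"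
        if "e \<in> grid D" for e
      proof -
        have "G v s ^ e v * \<Delta> s ^ (D - e v) = complex_of_real (x v) ^ e v * \<Delta> s ^ D" for v
        proof -
          have "e v \<le> D" using that by (auto simp: grid_def)
          then have "\<Delta> s ^ D = \<Delta> s ^ e v * \<Delta> s ^ (D - e v)"
            by (simp flip: power_add)
          then show ?thesis
            by (simp add: s(3)[symmetric] power_mult_distrib mult.assoc)
        qed
        then show ?thesis
          by (simp add: f_def prod.distrib N_def power_mult)
      qed
      have "complex_of_real (grid_poly D a x) * \<Delta> s ^ (D * N) = (\<Sum>e\<in>grid D. complex_of_real (a e) * f D UNIV e s)"
        by (simp add: grid_poly_def fx sum_distrib_right mult.assoc)
      also have "\<dots> = (\<Sum>e\<in>grid D. \<Sum>b\<in>exponents (N * D * c). complex_of_real (a e * k e b) * mon b s)"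
        by (simp add: k s sum_distrib_left mult.assoc)
      also have "\<dots> = (\<Sum>b\<in>exponents (N * D * c). complex_of_real (\<Sum>e\<in>grid D. a e * k e b) * mon b s)"
        by (subst sum.swap) (simp add: sum_distrib_right)
      also have "\<dots> = 0"
        using a by (intro sum.neutral) (auto simp: L_def)
      finally show ?thesis using s(2) by simp
    qed
    ultimately show "\<exists>L. finite L \<and>
        card L \<le> (N * c + 1) ^ (N - 1) * m ^ card J * (D + 1) ^ (CARD('v) - 1) \<and>
        (\<forall>a. (\<forall>l\<in>L. (\<Sum>e\<in>grid D. a e * l e) = 0) \<longrightarrow> (\<forall>x\<in>P. grid_poly D a x = 0))"
      by (intro exI[of _ L]) (auto simp: L_def)
  qed
qed

text \<open>Up to sign these coefficients are the elementary symmetric functions of the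
  \<open>f r\<close>; a further factor subtracts \<open>f r\<close> times the preceding
  coefficient.\<close>

lemma bounded_shift_coeff_prod:
  assumes "\<And>r. r \<in> R \<Longrightarrow> bounded_shift (f r)"
  shows "bounded_shift (\<lambda>s. coeff (\<Prod>r\<in>R. [:1, - f r s:]) k)"
  using assms
proof (induction R arbitrary: k rule: infinite_finite_induct)
  case (insert r R)
  then have IH: "bounded_shift (\<lambda>s. coeff (\<Prod>r\<in>R. [:1, - f r s:]) k)" for k by simp
  show ?case
  proof (cases k)
    case 0
    then show ?thesis using insert.hyps IH[of 0] by (simp add: coeff_mult_0 del: mult_pCons_left)
  next
    case (Suc k')
    have "bounded_shift (\<lambda>s. coeff (\<Prod>r\<in>R. [:1, - f r s:]) k
        - f r s * coeff (\<Prod>r\<in>R. [:1, - f r s:]) k')"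
      using insert.prems by (intro bounded_shift_diff bounded_shift_mult IH) auto
    then show ?thesis using insert.hyps Suc by simp
  qed
qed (auto intro: bounded_shift_zero bounded_shift_one)

end

section \<open>Power sums and elementary symmetric functions\<close>

text \<open>The derivative of \<open>P\<close> is the sum of \<open>- u r\<close> times
  \<open>P / (1 - u r X)\<close>. Expanding each quotient as a geometric series times
  \<open>P\<close> and comparing coefficients of index \<open>k\<close> gives the identity.\<close>

lemma newton_identity:
  fixes u :: "'m::finite \<Rightarrow> 'a::idom"
  defines "P \<equiv> \<Prod>r\<in>UNIV. [:1, - u r:]"
  shows "of_nat (Suc k) * coeff P (Suc k) = - (\<Sum>j\<le>k. (\<Sum>r\<in>UNIV. u r ^ (Suc k - j)) * coeff P j)"
proof -
  define Q where "Q r = (\<Prod>i\<in>UNIV - {r}. [:1, - u i:])" for r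
  have P: "P = [:1, - u r:] * Q r" for r
    unfolding P_def Q_def by (rule prod.remove) auto
  have Q: "coeff (Q r) k = (\<Sum>j\<le>k. u r ^ (k - j) * coeff P j)" for r k
  proof (induction k)
    case 0
    then show ?case by (simp add: P[of r])
  next
    case (Suc k)
    have "coeff (Q r) (Suc k) = coeff P (Suc k) + u r * coeff (Q r) k"
      by (simp add: P[of r])
    also have "\<dots> = coeff P (Suc k) + (\<Sum>j\<le>k. u r ^ (Suc k - j) * coeff P j)"
      by (simp add: Suc sum_distrib_left mult.assoc Suc_diff_le)
    finally show ?case by simp
  qed
  have "pderiv P = (\<Sum>r\<in>UNIV. smult (- u r) (Q r))"
    unfolding P_def Q_def by (simp add: pderiv_prod pderiv_pCons)
  then have "of_nat (Suc k) * coeff P (Suc k) = (\<Sum>r\<in>UNIV. - u r * coeff (Q r) k)"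
    by (simp add: coeff_pderiv[symmetric] coeff_sum del: of_nat_Suc)
  also have "\<dots> = - (\<Sum>r\<in>UNIV. \<Sum>j\<le>k. u r ^ (Suc k - j) * coeff P j)"
    by (simp add: Q sum_negf sum_distrib_left mult.assoc Suc_diff_le)
  also have "\<dots> = - (\<Sum>j\<le>k. (\<Sum>r\<in>UNIV. u r ^ (Suc k - j)) * coeff P j)"
    by (subst sum.swap) (simp add: sum_distrib_right)
  finally show ?thesis .
qed

text \<open>Newton's identities determine the coefficients recursively from the power sums, since
  positive integers can be cancelled in characteristic zero.\<close>

lemma coeff_prod_eq_if_power_sums_eq:
  fixes u v :: "'m::finite \<Rightarrow> 'a::{idom,ring_char_0}"
  assumes "\<And>l. l \<in> {1..K} \<Longrightarrow> (\<Sum>r\<in>UNIV. u r ^ l) = (\<Sum>r\<in>UNIV. v r ^ l)" "k \<le> K"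
  shows "coeff (\<Prod>r\<in>UNIV. [:1, - u r:]) k = coeff (\<Prod>r\<in>UNIV. [:1, - v r:]) k"
  using assms(2)
proof (induction k rule: less_induct)
  case (less k)
  show ?case
  proof (cases k)
    case 0
    then show ?thesis by (simp add: poly_0_coeff_0[symmetric] poly_prod)
  next
    case (Suc k')
    have "(\<Sum>r\<in>UNIV. u r ^ (Suc k' - l)) * coeff (\<Prod>r\<in>UNIV. [:1, - u r:]) l =
        (\<Sum>r\<in>UNIV. v r ^ (Suc k' - l)) * coeff (\<Prod>r\<in>UNIV. [:1, - v r:]) l" if "l \<le> k'" for l
    proof -
      have "(\<Sum>r\<in>UNIV. u r ^ (Suc k' - l)) = (\<Sum>r\<in>UNIV. v r ^ (Suc k' - l))"
        using that less.prems Suc by (intro assms(1)) auto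
      then show ?thesis using less that Suc by simp
    qed
    then have "of_nat (Suc k') * coeff (\<Prod>r\<in>UNIV. [:1, - u r:]) (Suc k') =
        of_nat (Suc k') * coeff (\<Prod>r\<in>UNIV. [:1, - v r:]) (Suc k')"
      unfolding newton_identity by simp
    then show ?thesis using Suc by (simp del: of_nat_Suc)
  qed
qed

text \<open>Reversing \<open>P\<close> gives the monic polynomial with factors
  \<open>X - u r\<close>, which has every \<open>u r\<close> as a root.\<close>

lemma integral_over_coeff_prod:
  fixes u :: "'m::finite \<Rightarrow> 'a::idom"
  defines "P \<equiv> \<Prod>r\<in>UNIV. [:1, - u r:]"
  shows "u r ^ CARD('m) = (\<Sum>k<CARD('m). - coeff P (CARD('m) - k) * u r ^ k)"
proof -
  define R where "R = (\<Prod>r\<in>UNIV. [:- u r, 1:])"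
  have deg: "degree R = CARD('m)"
    unfolding R_def by (subst degree_prod_eq_sum_degree) auto
  have "reflect_poly [:- a, 1:] = [:1, - a:]" for a :: 'a
    by (cases "a = 0") (simp_all add: reflect_poly_def)
  then have "reflect_poly R = P"
    by (simp add: R_def P_def reflect_poly_prod)
  then have coeff: "coeff R k = coeff P (CARD('m) - k)" if "k \<le> CARD('m)" for k
    using that deg coeff_reflect_poly[of R "CARD('m) - k"] by auto
  have P0: "coeff P 0 = 1"
    by (simp add: P_def poly_0_coeff_0[symmetric] poly_prod)
  have "0 = poly R (u r)"
    by (auto simp: R_def poly_prod)
  also have "\<dots> = (\<Sum>k\<le>CARD('m). coeff P (CARD('m) - k) * u r ^ k)"
    by (simp add: poly_altdef deg coeff)
  also have "\<dots> = (\<Sum>k<CARD('m). coeff P (CARD('m) - k) * u r ^ k) + u r ^ CARD('m)"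
    by (simp add: lessThan_Suc_atMost[symmetric] P0)
  finally show ?thesis
    by (simp add: sum_negf add_eq_0_iff)
qed

section \<open>Three kinds of thin sets of pairs\<close>

text \<open>The other coordinates are the parameters, one fewer than the variables; there are no
  integral elements and the denominator is 1.\<close>

lemma thin_coordinate_zero: "thin {z :: 'v::finite \<Rightarrow> real. z v0 = 0}"
proof -
  interpret monomial_module UNIV "- {v0}" "\<lambda>v z. complex_of_real (z v)" "{}" "\<lambda>(_::unit) _. 0" "Suc 0"
    by unfold_locales auto
  show ?thesis
  proof (rule thin_fractions)
    show "card (- {v0}) < CARD('v)"
      by (rule psubset_card_mono) auto
    show "bounded_shift (\<lambda>z. 1)" by (rule bounded_shift_one)
    show "bounded_shift (\<lambda>z. if v = v0 then 0 else complex_of_real (z v))" for v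
      using bounded_shift_zero bounded_shift_t[of v] by (cases "v = v0") auto
  qed auto
qed

text \<open>The coordinate sum of \<open>A \<xi>\<close> is linear in an entry of column
  \<open>j\<close> with coefficient \<xi>_j, so this entry is a fraction with denominator \<xi>_j in
  the other coordinates.\<close>

lemma thin_total_sum_zero:
  "thin {z :: ('m::finite \<times> 'n::finite) + 'n \<Rightarrow> real.
     z (Inr j) \<noteq> 0 \<and> (\<Sum>p\<in>UNIV. z (Inl p) * z (Inr (snd p))) = 0}" (is "thin ?P")
proof -
  obtain r :: 'm where True by simp
  define p0 where "p0 = (r, j)"
  interpret monomial_module ?P "- {Inl p0}" "\<lambda>v z. complex_of_real (z v)" "{}" "\<lambda>(_::unit) _. 0" "Suc 0"
    by unfold_locales auto
  define G where "G v z = (if v = Inl p0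
      then - (\<Sum>p\<in>UNIV - {p0}. complex_of_real (z (Inl p)) * complex_of_real (z (Inr (snd p))))
      else complex_of_real (z v) * complex_of_real (z (Inr j)))" for v z
  show ?thesis
  proof (rule thin_fractions)
    show "card (- {Inl p0 :: ('m \<times> 'n) + 'n}) < CARD(('m \<times> 'n) + 'n)"
      by (rule psubset_card_mono) (use finite[of UNIV] in auto)
    show "bounded_shift (\<lambda>z. complex_of_real (z (Inr j)))" by (rule bounded_shift_t) auto
    show "bounded_shift (G v)" for v
      unfolding G_def
      by (cases "v = Inl p0")
        (auto intro!: bounded_shift_uminus bounded_shift_sum bounded_shift_mult bounded_shift_t)
    fix z assume z: "z \<in> ?P"
    then have "z (Inl p0) * z (Inr j) + (\<Sum>p\<in>UNIV - {p0}. z (Inl p) * z (Inr (snd p))) = 0"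
      by (subst (asm) mem_Collect_eq, subst (asm) sum.remove[of _ p0]) (auto simp: p0_def)
    then have "z (Inl p0) * z (Inr j) = - (\<Sum>p\<in>UNIV - {p0}. z (Inl p) * z (Inr (snd p)))"
      by linarith
    from arg_cong[OF this, of complex_of_real]
    show "\<exists>s\<in>?P. complex_of_real (s (Inr j)) \<noteq> 0 \<and>
        (\<forall>v. complex_of_real (z v) * complex_of_real (s (Inr j)) = G v s)"
      using z by (intro bexI[of _ z]) (auto simp: G_def)
  qed
qed

text \<open>The parameters are \<open>\<xi>\<close>, \<open>x\<close>, the columns of \<open>A\<close> other than \<open>i\<close> and \<open>j\<close>, the vector
  \<open>A \<xi>\<close>, and the elementary symmetric functions of \<open>u = A x\<close> of index above \<open>n + 1\<close>: one less
  than the number of coordinates of \<open>(A, \<xi>)\<close>. The power sum equations identify the remaining elementary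
  symmetric functions of \<open>u\<close> with those of \<open>A \<xi>\<close>, so \<open>u\<close> is integral over the parameters, and
  Cramer's rule recovers the columns \<open>i\<close> and \<open>j\<close> of \<open>A\<close>.\<close>

lemma thin_independent_solution:
  fixes i j :: "'n::finite"
  assumes card: "CARD('n) < CARD('m::finite)" and ij: "i \<noteq> j"
  shows "thin {z :: ('m \<times> 'n) + 'n \<Rightarrow> real. \<exists>x :: 'n \<Rightarrow> complex.
     complex_of_real (z (Inr j)) * x i - complex_of_real (z (Inr i)) * x j \<noteq> 0 \<and>
     (\<forall>l\<in>{1..CARD('n) + 1}.
        (\<Sum>r\<in>UNIV. (\<Sum>k\<in>UNIV. complex_of_real (z (Inl (r, k))) * x k) ^ l) =
        (\<Sum>r\<in>UNIV. (\<Sum>k\<in>UNIV. complex_of_real (z (Inl (r, k))) * complex_of_real (z (Inr k))) ^ l))}"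
    (is "thin ?P")
proof -
  define a :: "'m \<Rightarrow> 'n \<Rightarrow> (('m \<times> 'n) + 'n \<Rightarrow> real) \<times> ('n \<Rightarrow> complex) \<Rightarrow> complex"
    where "a r k s = complex_of_real (fst s (Inl (r, k)))" for r k s
  define w :: "'n \<Rightarrow> (('m \<times> 'n) + 'n \<Rightarrow> real) \<times> ('n \<Rightarrow> complex) \<Rightarrow> complex"
    where "w k s = complex_of_real (fst s (Inr k))" for k s
  define x :: "'n \<Rightarrow> (('m \<times> 'n) + 'n \<Rightarrow> real) \<times> ('n \<Rightarrow> complex) \<Rightarrow> complex"
    where "x k s = snd s k" for k s
  define u where "u r s = (\<Sum>k\<in>UNIV. a r k s * x k s)" for r s
  define v where "v r s = (\<Sum>k\<in>UNIV. a r k s * w k s)" for r s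
  define sym where "sym k s = coeff (\<Prod>r\<in>UNIV. [:1, - u r s:]) k" for k s
  \<comment> \<open>Only the power sum equations define \<open>S\<close>; the nonvanishing minor
    enters later as the denominator \<open>\<Delta>\<close>.\<close>
  define S where "S = {s. \<forall>l\<in>{1..CARD('n) + 1}. (\<Sum>r\<in>UNIV. u r s ^ l) = (\<Sum>r\<in>UNIV. v r s ^ l)}"
  define I :: "('n + 'n + ('m \<times> 'n) + 'm + nat) set"
    where "I = UNIV <+> UNIV <+> (UNIV \<times> - {i, j}) <+> UNIV <+> {CARD('n) + 2..CARD('m)}"
  define t where "t = case_sum w (case_sum x (case_sum (\<lambda>(r, k). a r k) (case_sum v sym)))"
  interpret monomial_module S I t UNIV u "CARD('m)"
    by unfold_locales (auto simp: I_def)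
  have bs_w: "bounded_shift (w k)" for k
    using bounded_shift_t[of "Inl k"] by (auto simp: I_def t_def)
  have bs_x: "bounded_shift (x k)" for k
    using bounded_shift_t[of "Inr (Inl k)"] by (auto simp: I_def t_def)
  have bs_a: "bounded_shift (a r k)" if "k \<noteq> i" "k \<noteq> j" for r k
    using bounded_shift_t[of "Inr (Inr (Inl (r, k)))"] that by (auto simp: I_def t_def)
  have bs_v: "bounded_shift (v r)" for r
    using bounded_shift_t[of "Inr (Inr (Inr (Inl r)))"] by (auto simp: I_def t_def)
  have bs_sym: "bounded_shift (sym k)" if "k \<le> CARD('m)" for k
  proof (cases "k \<le> CARD('n) + 1")
    case True
    have "bounded_shift (\<lambda>s. coeff (\<Prod>r\<in>UNIV. [:1, - v r s:]) k)"
      by (rule bounded_shift_coeff_prod) (rule bs_v)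
    then show ?thesis
    proof (rule bounded_shift_cong)
      fix s assume "s \<in> S"
      then show "sym k s = coeff (\<Prod>r\<in>UNIV. [:1, - v r s:]) k"
        unfolding sym_def using True
        by (intro coeff_prod_eq_if_power_sums_eq[of "CARD('n) + 1"]) (auto simp: S_def)
    qed
  next
    case False
    then have "Inr (Inr (Inr (Inr k))) \<in> I"
      unfolding I_def using that by (intro InrI) auto
    then show ?thesis
      using bounded_shift_t[of "Inr (Inr (Inr (Inr k)))"] by (simp add: t_def)
  qed
  \<comment> \<open>The integral equation holds at every point. The equations of \<open>S\<close>
    enter through \<open>bs_sym\<close>, which bounds its coefficients.\<close>
  have bs_u: "bounded_shift (u r)" for r
  proof (rule bounded_shift_integral)
    show "bounded_shift (\<lambda>s. - sym (CARD('m) - k) s)" for k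
      by (intro bounded_shift_uminus bs_sym) simp
    show "u r s ^ CARD('m) = (\<Sum>k<CARD('m). - sym (CARD('m) - k) s * u r s ^ k)" for s
      unfolding sym_def by (rule integral_over_coeff_prod)
  qed simp
  define \<Delta> where "\<Delta> s = w j s * x i s - w i s * x j s" for s
  \<comment> \<open>What columns \<open>i\<close> and \<open>j\<close> contribute to
    \<open>A x\<close> and, in \<open>v'\<close>, to \<open>A \<xi>\<close>: for each row, a 2 by 2
    linear system for two entries with determinant \<open>\<Delta>\<close> up to sign.\<close>
  define u' where "u' r s = u r s - (\<Sum>k\<in>- {i, j}. a r k s * x k s)" for r s
  define v' where "v' r s = v r s - (\<Sum>k\<in>- {i, j}. a r k s * w k s)" for r s
  have bs: "bounded_shift (u' r)" "bounded_shift (v' r)" "bounded_shift \<Delta>" for r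
    unfolding u'_def v'_def \<Delta>_def
    by (intro bounded_shift_diff bounded_shift_sum bounded_shift_mult bs_u bs_v bs_a bs_x bs_w; simp)+
  have split: "(\<Sum>k\<in>UNIV. f k) = f i + f j + (\<Sum>k\<in>- {i, j}. f k)" for f :: "'n \<Rightarrow> complex"
    using ij sum.subset_diff[of "{i, j}" UNIV f] by (simp add: Compl_eq_Diff_UNIV)
  have cramer: "a r i s * \<Delta> s = w j s * u' r s - x j s * v' r s"
    "a r j s * \<Delta> s = x i s * v' r s - w i s * u' r s" for r s
    unfolding u'_def v'_def u_def v_def split \<Delta>_def by (simp_all add: algebra_simps)
  define G where "G = case_sum
      (\<lambda>(r, k) s. if k = i then w j s * u' r s - x j s * v' r s
        else if k = j then x i s * v' r s - w i s * u' r s else a r k s * \<Delta> s)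
      (\<lambda>k s. w k s * \<Delta> s)"
  show ?thesis
  proof (rule thin_fractions[where \<Delta> = \<Delta> and G = G])
    \<comment> \<open>With n = n' + 2 the count is 2n + m(n - 2) + m + (m - n - 1) = mn + n - 1, one
      below the number of coordinates.\<close>
    have "card {i, j} \<le> CARD('n)" by (rule card_mono) auto
    then obtain n' where n': "CARD('n) = n' + 2"
      using ij by (auto simp: numeral_2_eq_2 dest!: le_Suc_ex)
    have "card (- {i, j}) = n'"
      using ij n' by (simp add: Compl_eq_Diff_UNIV card_Diff_subset)
    then have "card I = 2 * CARD('n) + CARD('m) * n' + CARD('m) + (CARD('m) - (CARD('n) + 1))"
      by (simp add: I_def card_Plus card_cartesian_product)
    also have "\<dots> < CARD(('m \<times> 'n) + 'n)"
      using card n' by (simp add: algebra_simps)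
    finally show "card I < CARD(('m \<times> 'n) + 'n)" .
    show "bounded_shift (G c)" for c
    proof (cases c)
      case (Inl p)
      obtain r k where "p = (r, k)" by fastforce
      with Inl show ?thesis
        by (cases "k = i"; cases "k = j")
          (auto simp: G_def intro!: bounded_shift_diff bounded_shift_mult bs bs_a bs_x bs_w)
    next
      case (Inr k)
      then show ?thesis
        by (auto simp: G_def intro!: bounded_shift_mult bs bs_w)
    qed
    fix z assume "z \<in> ?P"
    then obtain y where y: "complex_of_real (z (Inr j)) * y i - complex_of_real (z (Inr i)) * y j \<noteq> 0"
      "\<forall>l\<in>{1..CARD('n) + 1}.
        (\<Sum>r\<in>UNIV. (\<Sum>k\<in>UNIV. complex_of_real (z (Inl (r, k))) * y k) ^ l) =
        (\<Sum>r\<in>UNIV. (\<Sum>k\<in>UNIV. complex_of_real (z (Inl (r, k))) * complex_of_real (z (Inr k))) ^ l)"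
      by blast
    have "(z, y) \<in> S" "\<Delta> (z, y) \<noteq> 0"
      using y by (simp_all add: S_def u_def v_def a_def x_def w_def \<Delta>_def)
    moreover have "complex_of_real (z c) * \<Delta> (z, y) = G c (z, y)" for c
    proof (cases c)
      case (Inl p)
      obtain r k where p: "p = (r, k)" by fastforce
      have "complex_of_real (z c) = a r k (z, y)" by (simp add: Inl p a_def)
      then show ?thesis using cramer by (simp add: G_def Inl p)
    next
      case (Inr k)
      then show ?thesis by (simp add: G_def w_def)
    qed
    ultimately show "\<exists>s\<in>S. \<Delta> s \<noteq> 0 \<and> (\<forall>c. complex_of_real (z c) * \<Delta> s = G c s)"
      by blast
  qed (rule bs)
qed

section \<open>Uniqueness outside the thin sets\<close>

lemma power_sum_permute_coords:
  assumes "bij \<pi>" shows "power_sum l (permute_coords \<pi> v) = power_sum l v"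
  using sum.reindex_bij_betw[OF assms, of "\<lambda>i. v $ i ^ l"]
  by (simp add: power_sum_def permute_coords_def)

text \<open>Power sums are symmetric, so the permutation disappears and one polynomial
  \<open>g\<close> can serve all permutations.\<close>

lemma q_eq:
  assumes "bij \<pi>"
  shows "q A (permute_coords \<pi> (A *v \<xi>)) l x =
    (\<Sum>r\<in>UNIV. (\<Sum>k\<in>UNIV. complex_of_real (A $ r $ k) * x $ k) ^ l) -
    (\<Sum>r\<in>UNIV. (\<Sum>k\<in>UNIV. complex_of_real (A $ r $ k) * complex_of_real (\<xi> $ k)) ^ l)"
  unfolding q_def power_sum_permute_coords[OF assms]
  by (simp add: power_sum_def matrix_vector_mult_def map_matrix_def)

theorem theorem1p1:
  assumes "CARD('n::finite) < CARD('m::finite)"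
  shows "\<exists>g :: (('m \<times> 'n) + 'n, real) mpoly. g \<noteq> 0 \<and>
    (\<forall>(A :: real ^ 'n ^ 'm) (\<xi> :: real ^ 'n) (\<pi> :: 'm \<Rightarrow> 'm).
       eval_mpoly g (entries A \<xi>) \<noteq> 0 \<longrightarrow> bij \<pi> \<longrightarrow>
       (let y = permute_coords \<pi> (A *v \<xi>) in
        \<forall>x :: complex ^ 'n. (\<forall>l\<in>{1..CARD('n) + 1}. q A y l x = 0) \<longleftrightarrow> x = complex_vec \<xi>))"
proof -
  obtain j :: 'n where True by simp
  define P where "P i = {z :: ('m \<times> 'n) + 'n \<Rightarrow> real. \<exists>x :: 'n \<Rightarrow> complex.
     complex_of_real (z (Inr j)) * x i - complex_of_real (z (Inr i)) * x j \<noteq> 0 \<and>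
     (\<forall>l\<in>{1..CARD('n) + 1}.
        (\<Sum>r\<in>UNIV. (\<Sum>k\<in>UNIV. complex_of_real (z (Inl (r, k))) * x k) ^ l) =
        (\<Sum>r\<in>UNIV. (\<Sum>k\<in>UNIV. complex_of_real (z (Inl (r, k))) * complex_of_real (z (Inr k))) ^ l))}" for i
  \<comment> \<open>The index \<open>j\<close> is fixed arbitrarily. Once \<xi>_j is nonzero, the
    minors with \<open>j\<close> alone decide whether \<open>x\<close> is a multiple of
    \<xi>.\<close>
  define bad where "bad = {z :: ('m \<times> 'n) + 'n \<Rightarrow> real. z (Inr j) = 0} \<union>
     {z. z (Inr j) \<noteq> 0 \<and> (\<Sum>p\<in>UNIV. z (Inl p) * z (Inr (snd p))) = 0} \<union> (\<Union>i\<in>- {j}. P i)"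
  have "thin bad"
    unfolding bad_def P_def
    by (intro thin_Un thin_UNION thin_coordinate_zero thin_total_sum_zero
        thin_independent_solution assms) auto
  then obtain g :: "(('m \<times> 'n) + 'n, real) mpoly"
    where g: "g \<noteq> 0" "\<And>z. z \<in> bad \<Longrightarrow> eval_mpoly g z = 0"
    using thin_imp_hypersurface by blast
  have "x = complex_vec \<xi>"
    if nz: "eval_mpoly g (entries A \<xi>) \<noteq> 0" and \<pi>: "bij \<pi>"
      and q: "\<forall>l\<in>{1..CARD('n) + 1}. q A (permute_coords \<pi> (A *v \<xi>)) l x = 0"
    for A :: "real ^ 'n ^ 'm" and \<xi> :: "real ^ 'n" and \<pi> x
  proof -
    have "entries A \<xi> \<notin> bad" using g(2) nz by blast
    then have j: "\<xi> $ j \<noteq> 0" and S: "(\<Sum>p\<in>UNIV. A $ fst p $ snd p * \<xi> $ snd p) \<noteq> 0"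
      and P: "\<And>i. i \<noteq> j \<Longrightarrow> entries A \<xi> \<notin> P i"
      by (auto simp: bad_def entries_def case_prod_unfold)
    note q = q[unfolded q_eq[OF \<pi>] right_minus_eq]
    have minor: "\<xi> $ j * x $ i = \<xi> $ i * x $ j" for i
    proof (cases "i = j")
      case False
      from P[OF this] q show ?thesis
        unfolding P_def entries_def by auto
    qed simp
    define c where "c = x $ j / \<xi> $ j"
    have x: "x $ i = c * \<xi> $ i" for i
      using minor[of i] j by (simp add: c_def field_simps)
    define \<sigma> where "\<sigma> = complex_of_real (\<Sum>p\<in>UNIV. A $ fst p $ snd p * \<xi> $ snd p)"
    have \<sigma>: "(\<Sum>r\<in>UNIV. \<Sum>k\<in>UNIV. complex_of_real (A $ r $ k) * complex_of_real (\<xi> $ k)) = \<sigma>"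
      unfolding \<sigma>_def by (simp add: sum.cartesian_product case_prod_unfold flip: UNIV_Times_UNIV)
    \<comment> \<open>Now \<open>x\<close> is \<open>c\<close> times \<xi>, and the equation with
      \<open>l = 1\<close> forces \<open>c = 1\<close> because the coordinate sum \<sigma> of
      \<open>A \<xi>\<close> is nonzero.\<close>
    have "(\<Sum>r\<in>UNIV. \<Sum>k\<in>UNIV. complex_of_real (A $ r $ k) * x $ k) = c * \<sigma>"
      unfolding \<sigma>[symmetric] x sum_distrib_left by (simp add: mult_ac)
    then have "c * \<sigma> = \<sigma>"
      using q[rule_format, of 1] \<sigma> by simp
    moreover have "\<sigma> \<noteq> 0" using S unfolding \<sigma>_def of_real_eq_0_iff .
    ultimately have "c = 1" by simp
    then show ?thesis using x by (simp add: vec_eq_iff complex_vec_def)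
  qed
  moreover have "q A (permute_coords \<pi> (A *v \<xi>)) l (complex_vec \<xi>) = 0" if "bij \<pi>"
    for A :: "real ^ 'n ^ 'm" and \<xi> \<pi> l
    unfolding q_eq[OF that] by (simp add: complex_vec_def)
  ultimately show ?thesis
    using g(1) unfolding Let_def by blast
qed

end
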